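(* Let $(\Omega,\mathcal{F},\mathbb{P})$ be a probability space, let $\mathcal{A}\subset L^\infty$ be an acceptance set and let $S=(S_0,S_1)$ be an eligible asset. Assume that $\rho_{\mathcal{A},S}$ is comonotonic. Then $\rho_{\mathcal{A}}$ is comonotonic and \[ \rho_{\mathcal{A},S}(X)=\rho_{\mathcal{A},R}(X)=-\rho_{\mathcal{A},S}(1)\,\rho_{\mathcal{A}}(X) \] for every $X\in L^\infty$, where $R=(-\rho_{\mathcal{A},S}(1),1)$.
   Context: $L^\infty=L^\infty(\Omega,\mathcal{F},\mathbb{P})$ is the space of (a.s.-equivalence classes of) essentially bounded real random variables, with the essential supremum norm $\|\cdot\|$ and the almost sure order; $L^\infty_+=\{X\in L^\infty : X\ge 0\}$. Constants are identified with constant random variables. An acceptance set is a nonempty proper subset $\mathcal{A}\subset L^\infty$ that is norm-closed and increasing, i.e. $\mathcal{A}+L^\infty_+\subset\mathcal{A}$. An eligible asset is a pair $S=(S_0,S_1)\in(0,\infty)\times L^\infty_+$ with $S_1\ge\varepsilon$ a.s. for some constant $\varepsilon>0$. The associated risk measure is $\rho_{\mathcal{A},S}:L^\infty\to\mathbb{R}$, $\rho_{\mathcal{A},S}(X)=\inf\{m\in\mathbb{R} : X+\tfrac{m}{S_0}S_1\in\mathcal{A}\}$ (finitely valued under these assumptions), and $\rho_{\mathcal{A}}(X)=\inf\{m\in\mathbb{R} : X+m\in\mathcal{A}\}$ (the case $S=(1,1)$). Two random variables $X,Y\in L^\infty$ are comonotone if there is a $\mathbb{P}\otimes\mathbb{P}$-null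 set $N$ such that $(X(\omega)-X(\omega'))(Y(\omega)-Y(\omega'))\ge0$ for all $(\omega,\omega')\in(\Omega\times\Omega)\setminus N$. A functional $\rho:L^\infty\to\mathbb{R}$ is comonotonic if $\rho(X+Y)=\rho(X)+\rho(Y)$ for all comonotone $X,Y\in L^\infty$. *)

theory Defs
  imports "HOL-Probability.Probability"
begin

text \<open>
  Elements of \<open>L\<^sup>\<infinity>\<close> are represented by functions; almost surely equal functions are not
  identified, but every notion below is stated up to almost sure equality. In particular an
  acceptance set is a union of equivalence classes, see \<open>acceptance_set_AE_cong\<close>.
\<close>

definition Linf :: "'a measure \<Rightarrow> ('a \<Rightarrow> real) set" where
  "Linf M = {X \<in> borel_measurable M. esssup M (\<lambda>\<omega>. ereal \<bar>X \<omega>\<bar>) < \<infinity>}"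

definition Linf_norm :: "'a measure \<Rightarrow> ('a \<Rightarrow> real) \<Rightarrow> real" where
  "Linf_norm M X = real_of_ereal (esssup M (\<lambda>\<omega>. ereal \<bar>X \<omega>\<bar>))"

definition Linf_plus :: "'a measure \<Rightarrow> ('a \<Rightarrow> real) set" where
  "Linf_plus M = {X \<in> Linf M. AE \<omega> in M. 0 \<le> X \<omega>}"

definition norm_closed :: "'a measure \<Rightarrow> ('a \<Rightarrow> real) set \<Rightarrow> bool" where
  "norm_closed M A \<longleftrightarrow>
     (\<forall>Y X. (\<forall>n. Y n \<in> A) \<and> X \<in> Linf M \<and>
        (\<lambda>n::nat. Linf_norm M (\<lambda>\<omega>. Y n \<omega> - X \<omega>)) \<longlonglongrightarrow> 0 \<longrightarrow> X \<in> A)"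

definition acceptance_set :: "'a measure \<Rightarrow> ('a \<Rightarrow> real) set \<Rightarrow> bool" where
  "acceptance_set M A \<longleftrightarrow>
     A \<noteq> {} \<and> A \<subset> Linf M \<and> norm_closed M A \<and>
     (\<forall>X\<in>A. \<forall>Z\<in>Linf_plus M. (\<lambda>\<omega>. X \<omega> + Z \<omega>) \<in> A)"

definition eligible_asset :: "'a measure \<Rightarrow> real \<times> ('a \<Rightarrow> real) \<Rightarrow> bool" where
  "eligible_asset M S \<longleftrightarrow>
     0 < fst S \<and> snd S \<in> Linf_plus M \<and> (\<exists>\<epsilon>>0. AE \<omega> in M. \<epsilon> \<le> snd S \<omega>)"

text \<open>
  The infimum is taken in the reals. For an acceptance set and an eligible asset the set is
  nonempty and bounded below, see \<open>risk_measure_finite\<close>.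
\<close>

definition risk_measure ::
  "('a \<Rightarrow> real) set \<Rightarrow> real \<times> ('a \<Rightarrow> real) \<Rightarrow> ('a \<Rightarrow> real) \<Rightarrow> real" where
  "risk_measure A S X = Inf {m. (\<lambda>\<omega>. X \<omega> + m / fst S * snd S \<omega>) \<in> A}"

definition cash_risk_measure :: "('a \<Rightarrow> real) set \<Rightarrow> ('a \<Rightarrow> real) \<Rightarrow> real" where
  "cash_risk_measure A X = Inf {m. (\<lambda>\<omega>. X \<omega> + m) \<in> A}"

definition comonotone :: "'a measure \<Rightarrow> ('a \<Rightarrow> real) \<Rightarrow> ('a \<Rightarrow> real) \<Rightarrow> bool" where
  "comonotone M X Y \<longleftrightarrow>
     (AE (\<omega>, \<omega>') in M \<Otimes>\<^sub>M M. 0 \<le> (X \<omega> - X \<omega>') * (Y \<omega> - Y \<omega>'))"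

definition comonotonic :: "'a measure \<Rightarrow> (('a \<Rightarrow> real) \<Rightarrow> real) \<Rightarrow> bool" where
  "comonotonic M \<rho> \<longleftrightarrow>
     (\<forall>X\<in>Linf M. \<forall>Y\<in>Linf M. comonotone M X Y \<longrightarrow> \<rho> (\<lambda>\<omega>. X \<omega> + Y \<omega>) = \<rho> X + \<rho> Y)"

lemma Linf_iff:
  "X \<in> Linf M \<longleftrightarrow> X \<in> borel_measurable M \<and> (\<exists>C. AE \<omega> in M. \<bar>X \<omega>\<bar> \<le> C)"
proof (intro iffI conjI)
  assume X: "X \<in> Linf M"
  then show "X \<in> borel_measurable M" by (simp add: Linf_def)
  from X have "esssup M (\<lambda>\<omega>. ereal \<bar>X \<omega>\<bar>) < \<infinity>" by (simp add: Linf_def)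
  then obtain C where C: "esssup M (\<lambda>\<omega>. ereal \<bar>X \<omega>\<bar>) \<le> ereal C"
    by (cases "esssup M (\<lambda>\<omega>. ereal \<bar>X \<omega>\<bar>)") auto
  have "AE \<omega> in M. ereal \<bar>X \<omega>\<bar> \<le> esssup M (\<lambda>\<omega>. ereal \<bar>X \<omega>\<bar>)" by (rule esssup_AE)
  then have "AE \<omega> in M. \<bar>X \<omega>\<bar> \<le> C"
  proof eventually_elim
    case (elim \<omega>)
    from order_trans[OF this C] show ?case by simp
  qed
  then show "\<exists>C. AE \<omega> in M. \<bar>X \<omega>\<bar> \<le> C" by blast
next
  assume X: "X \<in> borel_measurable M \<and> (\<exists>C. AE \<omega> in M. \<bar>X \<omega>\<bar> \<le> C)"
  then obtain C where C: "AE \<omega> in M. ereal \<bar>X \<omega>\<bar> \<le> ereal C" by auto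
  have "esssup M (\<lambda>\<omega>. ereal \<bar>X \<omega>\<bar>) \<le> ereal C"
    by (rule esssup_I) (use X C in auto)
  then show "X \<in> Linf M" using X by (auto simp: Linf_def)
qed

lemma Linf_lin:
  assumes "X \<in> Linf M" "Y \<in> Linf M"
  shows "(\<lambda>\<omega>. X \<omega> + c * Y \<omega>) \<in> Linf M"
proof -
  obtain C D where "AE \<omega> in M. \<bar>X \<omega>\<bar> \<le> C" "AE \<omega> in M. \<bar>Y \<omega>\<bar> \<le> D"
    using assms by (auto simp: Linf_iff)
  then have "AE \<omega> in M. \<bar>X \<omega> + c * Y \<omega>\<bar> \<le> C + \<bar>c\<bar> * D"
  proof eventually_elim
    case (elim \<omega>)
    have "\<bar>X \<omega> + c * Y \<omega>\<bar> \<le> \<bar>X \<omega>\<bar> + \<bar>c\<bar> * \<bar>Y \<omega>\<bar>"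
      by (metis abs_mult abs_triangle_ineq)
    with elim mult_left_mono[of "\<bar>Y \<omega>\<bar>" D "\<bar>c\<bar>"] show ?case by linarith
  qed
  then show ?thesis using assms by (auto simp: Linf_iff)
qed

lemma acceptance_set_mono:
  assumes A: "acceptance_set M A" and X: "X \<in> A" and Y: "Y \<in> Linf M"
    and le: "AE \<omega> in M. X \<omega> \<le> Y \<omega>"
  shows "Y \<in> A"
proof -
  have XL: "X \<in> Linf M" using A X unfolding acceptance_set_def by blast
  have "(\<lambda>\<omega>. Y \<omega> + (-1) * X \<omega>) \<in> Linf M" by (rule Linf_lin[OF Y XL])
  then have Z: "(\<lambda>\<omega>. Y \<omega> - X \<omega>) \<in> Linf_plus M" using le by (simp add: Linf_plus_def)
  have "\<forall>X\<in>A. \<forall>Z\<in>Linf_plus M. (\<lambda>\<omega>. X \<omega> + Z \<omega>) \<in> A"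
    using A unfolding acceptance_set_def by (elim conjE)
  from bspec[OF bspec[OF this X] Z]
  show ?thesis by simp
qed

lemma acceptance_set_AE_cong:
  assumes "acceptance_set M A" "X \<in> A" "Y \<in> borel_measurable M" "AE \<omega> in M. X \<omega> = Y \<omega>"
  shows "Y \<in> A"
proof -
  have "X \<in> Linf M" using assms(1,2) unfolding acceptance_set_def by blast
  then obtain C where "AE \<omega> in M. \<bar>X \<omega>\<bar> \<le> C" by (auto simp: Linf_iff)
  then have "AE \<omega> in M. \<bar>Y \<omega>\<bar> \<le> C" using assms(4) by eventually_elim simp
  then have "Y \<in> Linf M" using assms(3) by (auto simp: Linf_iff)
  moreover have "AE \<omega> in M. X \<omega> \<le> Y \<omega>" using assms(4) by eventually_elim simp
  ultimately show ?thesis using acceptance_set_mono assms(1,2) by blast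
qed

lemma eligible_asset_dominates:
  assumes S: "eligible_asset M S" and X: "X \<in> Linf M" and Y: "Y \<in> Linf M"
  shows "\<exists>c\<ge>0. \<forall>m\<ge>c. AE \<omega> in M. X \<omega> \<le> Y \<omega> + m / fst S * snd S \<omega>"
proof -
  obtain C D where CD: "AE \<omega> in M. \<bar>X \<omega>\<bar> \<le> C" "AE \<omega> in M. \<bar>Y \<omega>\<bar> \<le> D"
    using X Y by (auto simp: Linf_iff)
  obtain e where e: "e > 0" "AE \<omega> in M. e \<le> snd S \<omega>" and S0: "fst S > 0"
    using S by (auto simp: eligible_asset_def)
  define c where "c = (\<bar>C\<bar> + \<bar>D\<bar>) / e * fst S"
  have c0: "c \<ge> 0" using e S0 by (simp add: c_def)
  have "AE \<omega> in M. X \<omega> \<le> Y \<omega> + m / fst S * snd S \<omega>" if m: "m \<ge> c" for m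
    using CD e(2)
  proof eventually_elim
    case (elim \<omega>)
    have "c / fst S \<le> m / fst S" using m S0 by (simp add: divide_right_mono)
    moreover have "c / fst S = (\<bar>C\<bar> + \<bar>D\<bar>) / e" using S0 by (simp add: c_def)
    ultimately have *: "(\<bar>C\<bar> + \<bar>D\<bar>) / e \<le> m / fst S" by simp
    have "0 \<le> (\<bar>C\<bar> + \<bar>D\<bar>) / e" using e(1) by simp
    with * have "0 \<le> m / fst S" by linarith
    with * have "m / fst S * snd S \<omega> \<ge> (\<bar>C\<bar> + \<bar>D\<bar>) / e * e"
      using elim(3) e(1) by (intro mult_mono) simp_all
    then show ?case using e(1) elim by simp
  qed
  then show ?thesis using c0 by blast
qed

lemma risk_measure_finite:
  assumes A: "acceptance_set M A" and S: "eligible_asset M S" and X: "X \<in> Linf M"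
  shows "{m. (\<lambda>\<omega>. X \<omega> + m / fst S * snd S \<omega>) \<in> A} \<noteq> {}"
    and "bdd_below {m. (\<lambda>\<omega>. X \<omega> + m / fst S * snd S \<omega>) \<in> A}"
proof -
  have S1: "snd S \<in> Linf M" using S by (simp add: eligible_asset_def Linf_plus_def)
  obtain Y where Y: "Y \<in> A" "Y \<in> Linf M" using A unfolding acceptance_set_def by blast
  obtain c where "AE \<omega> in M. Y \<omega> \<le> X \<omega> + c / fst S * snd S \<omega>"
    using eligible_asset_dominates[OF S Y(2) X] by blast
  then have "(\<lambda>\<omega>. X \<omega> + c / fst S * snd S \<omega>) \<in> A"
    by (intro acceptance_set_mono[OF A Y(1)] Linf_lin[OF X S1])
  then show "{m. (\<lambda>\<omega>. X \<omega> + m / fst S * snd S \<omega>) \<in> A} \<noteq> {}" by blast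
  obtain Z where Z: "Z \<notin> A" "Z \<in> Linf M" using A unfolding acceptance_set_def by blast
  obtain d where d: "\<And>m. m \<ge> d \<Longrightarrow> AE \<omega> in M. X \<omega> \<le> Z \<omega> + m / fst S * snd S \<omega>"
    using eligible_asset_dominates[OF S X Z(2)] by blast
  show "bdd_below {m. (\<lambda>\<omega>. X \<omega> + m / fst S * snd S \<omega>) \<in> A}"
  proof (rule bdd_belowI[of _ "- d"], rule ccontr)
    fix m assume m: "m \<in> {m. (\<lambda>\<omega>. X \<omega> + m / fst S * snd S \<omega>) \<in> A}" and "\<not> - d \<le> m"
    then have "AE \<omega> in M. X \<omega> \<le> Z \<omega> + (- m) / fst S * snd S \<omega>" by (intro d) simp
    then have "AE \<omega> in M. X \<omega> + m / fst S * snd S \<omega> \<le> Z \<omega>"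
      by eventually_elim (simp add: algebra_simps)
    then have "Z \<in> A" using acceptance_set_mono[OF A _ Z(2)] m by blast
    with Z(1) show False by simp
  qed
qed

end

theory Submission
  imports Defs
begin

text \<open>
  The acceptance set is the sublevel set \<open>{\<rho> \<le> 0}\<close> of \<open>\<rho> = \<rho>\<^bsub>A,S\<^esub>\<close>. Constants are comonotone
  with every random variable, so comonotonicity makes \<open>c \<mapsto> \<rho>(c)\<close> additive; being
  monotone it is linear, and \<open>\<rho>(X + c) = \<rho>(X) + c \<rho>(1)\<close> with \<open>\<rho>(1) < 0\<close>. Hence
  \<open>X + m \<in> A\<close> if and only if \<open>\<rho>(X) \<le> - \<rho>(1) m\<close>, from which both other risk measures are
  read off.
\<close>

text \<open>Additivity settles the integers; monotonicity keeps the defect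
  \<open>f y - y * f 1\<close> bounded uniformly in \<open>y\<close>. As the defect is itself
  additive, boundedness forces it to vanish.\<close>

lemma antimono_additive_imp_linear:
  fixes f :: "real \<Rightarrow> real"
  assumes add: "\<And>x y. f (x + y) = f x + f y" and anti: "\<And>x y. x \<le> y \<Longrightarrow> f y \<le> f x"
  shows "f x = x * f 1"
proof -
  have f0: "f 0 = 0" using add[of 0 0] by simp
  have nat: "f (real n * y) = real n * f y" for n y
    by (induction n) (simp_all add: f0 add distrib_right)
  have minus: "f (- y) = - f y" for y using add[of y "- y"] f0 by simp
  have int: "f (of_int k) = of_int k * f 1" for k
  proof (cases k)
    case (nonneg n)
    then show ?thesis using nat[of n 1] by simp
  next
    case (neg n)
    then have "f (of_int k) = - f (real (Suc n) * 1)" using minus[of "real (Suc n)"] by simp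
    also have "\<dots> = of_int k * f 1" unfolding nat neg by (simp add: algebra_simps)
    finally show ?thesis .
  qed
  have f1: "f 1 \<le> 0" using anti[of 0 1] f0 by simp
  have bound: "\<bar>f y - y * f 1\<bar> \<le> - f 1" for y
  proof -
    have fl: "of_int \<lfloor>y\<rfloor> \<le> y" "y \<le> of_int (\<lfloor>y\<rfloor> + 1)" by linarith+
    \<comment> \<open>Both \<open>f y\<close> and \<open>y * f 1\<close> lie between the values of
      \<open>f\<close> at the integers around \<open>y\<close>, and these values differ by exactly
      \<open>- f 1\<close>.\<close>
    have "of_int (\<lfloor>y\<rfloor> + 1) * f 1 \<le> f y" "f y \<le> of_int \<lfloor>y\<rfloor> * f 1"
      using anti[OF fl(1)] anti[OF fl(2)] unfolding int by simp_all
    moreover have "y * f 1 \<le> of_int \<lfloor>y\<rfloor> * f 1" "of_int (\<lfloor>y\<rfloor> + 1) * f 1 \<le> y * f 1"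
      using fl f1 by (simp_all only: mult_right_mono_neg)
    ultimately show ?thesis by (simp add: algebra_simps)
  qed
  \<comment> \<open>The bound at \<open>real n * x\<close>: the defect scales with \<open>n\<close>,
    while its bound does not depend on \<open>n\<close>.\<close>
  have "real n * \<bar>f x - x * f 1\<bar> \<le> - f 1" for n
  proof -
    have "real n * \<bar>f x - x * f 1\<bar> = \<bar>f (real n * x) - (real n * x) * f 1\<bar>"
      by (simp add: nat abs_mult mult.assoc flip: right_diff_distrib)
    with bound show ?thesis by simp
  qed
  then have "\<bar>f x - x * f 1\<bar> \<le> 0"
    by (meson ex_less_of_nat_mult not_le)
  then show ?thesis by simp
qed

lemma Linf_norm_cmult:
  assumes "0 < c"
  shows "Linf_norm M (\<lambda>\<omega>. c * X \<omega>) = c * Linf_norm M X"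
proof -
  have "(\<lambda>\<omega>. ereal \<bar>c * X \<omega>\<bar>) = (\<lambda>\<omega>. ereal c * ereal \<bar>X \<omega>\<bar>)"
    using assms by (simp add: abs_mult)
  then show ?thesis
    by (simp only: Linf_norm_def esssup_cmult[OF assms] real_of_ereal_mult real_of_ereal.simps)
qed

lemma Linf_const: "(\<lambda>_. c) \<in> Linf M"
  by (auto simp: Linf_iff)

lemma comonotone_const: "comonotone M X (\<lambda>_. c)"
  by (simp add: comonotone_def case_prod_beta')

text \<open>The infimum is attained: every level above it is accepted by monotonicity of
  \<open>A\<close>, and norm-closedness carries acceptance down to the limit level.\<close>

lemma risk_measure_le_iff:
  assumes A: "acceptance_set M A" and S: "eligible_asset M S" and X: "X \<in> Linf M"
  shows "risk_measure A S X \<le> m \<longleftrightarrow> (\<lambda>\<omega>. X \<omega> + m / fst S * snd S \<omega>) \<in> A"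
    (is "_ \<longleftrightarrow> ?P m")
proof
  note finite = risk_measure_finite[OF A S X]
  show "risk_measure A S X \<le> m" if "?P m"
    unfolding risk_measure_def using finite(2) that by (intro cInf_lower) auto
  assume le: "risk_measure A S X \<le> m"
  have S0: "0 < fst S" and S1: "snd S \<in> Linf M" "AE \<omega> in M. 0 \<le> snd S \<omega>"
    using S by (auto simp: eligible_asset_def Linf_plus_def)
  \<comment> \<open>An infimum below \<open>m'\<close> yields an accepted level
    \<open>k < m'\<close>; as \<open>snd S\<close> is nonnegative, raising \<open>k\<close> to
    \<open>m'\<close> only enlarges the position.\<close>
  have acc: "?P m'" if "m < m'" for m'
  proof -
    have "Inf {m. ?P m} < m'" using le that unfolding risk_measure_def by simp
    then obtain k where k: "?P k" "k < m'"
      using cInf_lessD[OF finite(1)] by blast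
    have "AE \<omega> in M. X \<omega> + k / fst S * snd S \<omega> \<le> X \<omega> + m' / fst S * snd S \<omega>"
      using S1(2)
      by eventually_elim (use k(2) S0 in \<open>simp add: mult_right_mono divide_right_mono\<close>)
    then show ?thesis
      by (intro acceptance_set_mono[OF A k(1)] Linf_lin[OF X S1(1)])
  qed
  \<comment> \<open>\<open>c n\<close> is the coefficient of \<open>snd S\<close> in the difference
    between the positions at levels \<open>m + inverse (real (Suc n))\<close> and \<open>m\<close>.
    Hence the norm of this difference is \<open>c n\<close> times that of \<open>snd S\<close> and
    tends to 0.\<close>
  define c where "c n = inverse (real (Suc n)) / fst S" for n
  have c: "0 < c n" for n using S0 by (simp add: c_def)
  define Y where "Y n \<omega> = X \<omega> + (m + inverse (real (Suc n))) / fst S * snd S \<omega>" for n \<omega>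
  define Z where "Z \<omega> = X \<omega> + m / fst S * snd S \<omega>" for \<omega>
  have "Y n \<in> A" for n
    using acc[of "m + inverse (real (Suc n))"] by (simp add: Y_def[abs_def])
  moreover have "Z \<in> Linf M"
    unfolding Z_def by (rule Linf_lin[OF X S1(1)])
  moreover have "(\<lambda>n. Linf_norm M (\<lambda>\<omega>. Y n \<omega> - Z \<omega>)) \<longlonglongrightarrow> 0"
  proof -
    have "(\<lambda>n. Linf_norm M (\<lambda>\<omega>. Y n \<omega> - Z \<omega>)) = (\<lambda>n. c n * Linf_norm M (snd S))"
      unfolding Linf_norm_cmult[OF c, symmetric]
      by (simp add: Y_def Z_def c_def add_divide_distrib distrib_right)
    moreover have "(\<lambda>n. c n * Linf_norm M (snd S)) \<longlonglongrightarrow> 0 / fst S * Linf_norm M (snd S)"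
      unfolding c_def using S0 by (intro tendsto_intros LIMSEQ_inverse_real_of_nat) simp
    ultimately show ?thesis by simp
  qed
  moreover have "norm_closed M A" using A unfolding acceptance_set_def by blast
  ultimately have "Z \<in> A" unfolding norm_closed_def by blast
  then show "?P m" unfolding Z_def .
qed

lemma risk_measure_nonpos_iff:
  assumes "acceptance_set M A" "eligible_asset M S" "X \<in> Linf M"
  shows "risk_measure A S X \<le> 0 \<longleftrightarrow> X \<in> A"
  using risk_measure_le_iff[OF assms, of 0] by simp

lemma risk_measure_antimono:
  assumes A: "acceptance_set M A" and S: "eligible_asset M S"
    and X: "X \<in> Linf M" and Y: "Y \<in> Linf M" and le: "AE \<omega> in M. X \<omega> \<le> Y \<omega>"
  shows "risk_measure A S Y \<le> risk_measure A S X"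
proof -
  have S1: "snd S \<in> Linf M" using S by (auto simp: eligible_asset_def Linf_plus_def)
  let ?m = "risk_measure A S X"
  \<comment> \<open>The level \<open>?m\<close> is itself accepted because the infimum is
    attained.\<close>
  have "(\<lambda>\<omega>. X \<omega> + ?m / fst S * snd S \<omega>) \<in> A"
    unfolding risk_measure_le_iff[OF A S X, symmetric] ..
  moreover have "AE \<omega> in M. X \<omega> + ?m / fst S * snd S \<omega> \<le> Y \<omega> + ?m / fst S * snd S \<omega>"
    using le by eventually_elim simp
  ultimately show ?thesis
    unfolding risk_measure_le_iff[OF A S Y]
    using acceptance_set_mono[OF A _ Linf_lin[OF Y S1]] by blast
qed

text \<open>Since \<open>snd S\<close> is essentially bounded, a small positive amount of the asset
  can be sold out of the constant 1 so that what remains is nonnegative, hence accepted.\<close>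

lemma risk_measure_one_neg:
  assumes A: "acceptance_set M A" and S: "eligible_asset M S" and zero: "(\<lambda>_. 0) \<in> A"
  shows "risk_measure A S (\<lambda>_. 1) < 0"
proof -
  have S0: "0 < fst S" and S1: "snd S \<in> Linf M" "AE \<omega> in M. 0 \<le> snd S \<omega>"
    using S by (auto simp: eligible_asset_def Linf_plus_def)
  obtain C where C: "AE \<omega> in M. \<bar>snd S \<omega>\<bar> \<le> C" using S1(1) by (auto simp: Linf_iff)
  \<comment> \<open>The maximum with 1 makes \<open>K\<close> positive, so that dividing by it is
    safe. As \<open>K\<close> bounds \<open>snd S\<close>, selling \<open>1 / K\<close> units takes
    away at most 1.\<close>
  define K where "K = max 1 C"
  have K: "0 < K" by (simp add: K_def)
  have "AE \<omega> in M. 0 \<le> 1 + (- (fst S / K)) / fst S * snd S \<omega>"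
    using C by eventually_elim (use S0 K in \<open>simp add: K_def field_simps\<close>)
  then have "(\<lambda>\<omega>. 1 + (- (fst S / K)) / fst S * snd S \<omega>) \<in> A"
    by (intro acceptance_set_mono[OF A zero] Linf_lin[OF Linf_const S1(1)])
  then have "risk_measure A S (\<lambda>_. 1) \<le> - (fst S / K)"
    using risk_measure_le_iff[OF A S Linf_const] by blast
  also have "\<dots> < 0" using S0 K by simp
  finally show ?thesis .
qed

text \<open>Stands in for cash additivity although the eligible asset need not be cash: each unit of
  a constant shift has the same price, \<open>risk_measure A S (\<lambda>_. 1)\<close>.\<close>

lemma comonotonic_cash_additive:
  assumes A: "acceptance_set M A" and S: "eligible_asset M S"
    and com: "comonotonic M (risk_measure A S)" and X: "X \<in> Linf M"
  shows "risk_measure A S (\<lambda>\<omega>. X \<omega> + c) = risk_measure A S X + c * risk_measure A S (\<lambda>_. 1)"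
proof -
  have add: "risk_measure A S (\<lambda>\<omega>. Y \<omega> + d) = risk_measure A S Y + risk_measure A S (\<lambda>_. d)"
    if "Y \<in> Linf M" for Y d
    using com that Linf_const comonotone_const unfolding comonotonic_def by blast
  have "risk_measure A S (\<lambda>_. c) = c * risk_measure A S (\<lambda>_. 1)"
    by (rule antimono_additive_imp_linear[of "\<lambda>c. risk_measure A S (\<lambda>_. c)"])
      (use add[OF Linf_const] risk_measure_antimono[OF A S Linf_const Linf_const] in auto)
  with add[OF X] show ?thesis by simp
qed

theorem proposition2p15:
  fixes M :: "'a measure" and A :: "('a \<Rightarrow> real) set" and S :: "real \<times> ('a \<Rightarrow> real)"
  assumes "prob_space M"
    and "acceptance_set M A"
    and "eligible_asset M S"
    and "comonotonic M (risk_measure A S)"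
  shows "comonotonic M (cash_risk_measure A) \<and>
    (let R = (- risk_measure A S (\<lambda>_. 1), \<lambda>_. 1) in
      eligible_asset M R \<and>
      (\<forall>X\<in>Linf M.
         risk_measure A S X = risk_measure A R X \<and>
         risk_measure A R X = - risk_measure A S (\<lambda>_. 1) * cash_risk_measure A X))"
proof -
  note A = assms(2) and S = assms(3) and com = assms(4)
  define r where "r = - risk_measure A S (\<lambda>_. 1)"
  \<comment> \<open>The shift rule at constant positions forces the normalisation
    \<open>\<rho>(0) = 0\<close>. This puts the constant 0 into \<open>A\<close>, as
    \<open>risk_measure_one_neg\<close> requires.\<close>
  have "risk_measure A S (\<lambda>\<omega>. 0 + 0) = 0"
    using comonotonic_cash_additive[OF A S com Linf_const, of 0 1]
      comonotonic_cash_additive[OF A S com Linf_const, of 1 "- 1"] by simp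
  then have "(\<lambda>_. 0) \<in> A"
    using risk_measure_nonpos_iff[OF A S Linf_const, of 0] by simp
  then have r: "0 < r" using risk_measure_one_neg[OF A S] by (simp add: r_def)
  have acc: "(\<lambda>\<omega>. X \<omega> + m) \<in> A \<longleftrightarrow> risk_measure A S X \<le> r * m" if X: "X \<in> Linf M" for X m
  proof -
    have "(\<lambda>\<omega>. X \<omega> + m) \<in> Linf M"
      using Linf_lin[OF X Linf_const, of m 1] by simp
    then have "(\<lambda>\<omega>. X \<omega> + m) \<in> A \<longleftrightarrow> risk_measure A S (\<lambda>\<omega>. X \<omega> + m) \<le> 0"
      using risk_measure_nonpos_iff[OF A S] by blast
    then show ?thesis
      by (auto simp: comonotonic_cash_additive[OF A S com X] r_def mult.commute)
  qed
  have cash: "cash_risk_measure A X = risk_measure A S X / r" if X: "X \<in> Linf M" for X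
  proof -
    \<comment> \<open>The accepted cash amounts form a closed half-line, whose infimum is its
      endpoint.\<close>
    have "{m. (\<lambda>\<omega>. X \<omega> + m) \<in> A} = {risk_measure A S X / r..}"
      unfolding acc[OF X] using r by (auto simp: field_simps)
    then show ?thesis by (simp add: cash_risk_measure_def)
  qed
  have R: "risk_measure A (r, \<lambda>_. 1) X = risk_measure A S X" if X: "X \<in> Linf M" for X
  proof -
    \<comment> \<open>The initial price \<open>r\<close> of \<open>R\<close> cancels the factor
      \<open>r\<close> in \<open>acc\<close>, so the threshold becomes \<open>\<rho>(X)\<close>
      itself.\<close>
    have "{m. (\<lambda>\<omega>. X \<omega> + m / r * 1) \<in> A} = {risk_measure A S X..}"
      using r by (auto simp: acc[OF X])
    then show ?thesis unfolding risk_measure_def[of A "(r, _)"] by simp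
  qed
  have "eligible_asset M (r, \<lambda>_. 1)"
    using r Linf_const by (auto simp: eligible_asset_def Linf_plus_def intro!: exI[of _ "1::real"])
  moreover have "comonotonic M (cash_risk_measure A)"
    unfolding comonotonic_def
  proof (intro ballI impI)
    fix X Y assume XY: "X \<in> Linf M" "Y \<in> Linf M" "comonotone M X Y"
    \<comment> \<open>By \<open>cash\<close>, the cash risk measure is a constant multiple of
      \<open>\<rho>\<close> on \<open>Linf M\<close>, so it inherits additivity on comonotone pairs;
      the sum must lie in \<open>Linf M\<close> for \<open>cash\<close> to apply to it.\<close>
    have "(\<lambda>\<omega>. X \<omega> + Y \<omega>) \<in> Linf M" using Linf_lin[OF XY(1,2), of 1] by simp
    moreover have "risk_measure A S (\<lambda>\<omega>. X \<omega> + Y \<omega>) = risk_measure A S X + risk_measure A S Y"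
      using com XY unfolding comonotonic_def by blast
    ultimately show
      "cash_risk_measure A (\<lambda>\<omega>. X \<omega> + Y \<omega>) = cash_risk_measure A X + cash_risk_measure A Y"
      using XY by (simp add: cash add_divide_distrib)
  qed
  ultimately show ?thesis
    using r R cash unfolding Let_def by (simp flip: r_def)
qed

end
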